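(* Let $D$ be a $\mathcal{C}^{1,1}$-smooth convex bounded domain in $\mathbb{C}^2$ admitting a defining function of the form $\varrho(z)=-\operatorname{Re} z_1+\psi(|z_2|)$ near the origin, where $\psi$ is a $\mathcal{C}^{1,1}$-smooth nonnegative convex function near $0$ satisfying $\psi(0)=0$ and $$\limsup_{x\to 0}\frac{\log\psi(|x|)}{\log|x|}=\infty.$$ Then $D$ is not Gromov $k$-hyperbolic.
   Context: Points of $\mathbb{C}^2$ are written $z=(z_1,z_2)$. The function $\varrho$ is a defining function of $D$ near the origin in the sense that $D\cap U=\{z\in U:\varrho(z)<0\}$ for some neighborhood $U$ of $0$. The convention $\log 0=-\infty$ is used, so the limsup condition holds in particular if $\psi(|x|)=0$ for $|x|$ small. Let $\mathbb{D}$ be the open unit disc in $\mathbb{C}$. For a domain $D\subset\mathbb{C}^n$, the Lempert function is $l_D(z,w)=\inf\{\tanh^{-1}|\alpha| : \exists\,\varphi:\mathbb{D}\to D \text{ holomorphic with } \varphi(0)=z,\ \varphi(\alpha)=w\}$, and the Kobayashi distance $k_D$ is the largest pseudodistance on $D$ not exceeding $l_D$. For a metric space $(X,d)$ and $x,y,z\in X$, the Gromov product is $(x,y)_z=d(x,z)+d(z,y)-d(x,y)$. Put $S_d(p,q,x,w)=\min\{(p,x)_w,(x,q)_w\}-(p,q)_w$. The space $(X,d)$ is Gromov hyperbolic if $\sup_{p,q,x,w\in X}S_d(p,q,x,w)<\infty$. A domain $D$ is Gromov $k$-hyperbolic if $(D,k_D)$ is Gromov hyperbolic. *)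

theory Defs
  imports "HOL-Complex_Analysis.Complex_Analysis"
begin

text \<open>
  Points of \<open>\<complex>\<^sup>n\<close> are vectors of type \<open>complex ^ 'n\<close>. The Lempert function takes
  values in the extended reals, so that an infimum over an empty family of discs is \<open>\<infinity>\<close>.
\<close>

definition lempert :: "(complex ^ 'n) set \<Rightarrow> complex ^ 'n \<Rightarrow> complex ^ 'n \<Rightarrow> ereal" where
  "lempert D z w =
    Inf {ereal (artanh (cmod \<alpha>)) | \<alpha>. \<alpha> \<in> ball 0 1 \<and>
      (\<exists>\<phi> :: complex \<Rightarrow> complex ^ 'n.
         (\<forall>i. (\<lambda>\<zeta>. \<phi> \<zeta> $ i) holomorphic_on ball 0 1) \<and>
         \<phi> ` ball 0 1 \<subseteq> D \<and> \<phi> 0 = z \<and> \<phi> \<alpha> = w)}"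

definition pseudodistance_on :: "'a set \<Rightarrow> ('a \<Rightarrow> 'a \<Rightarrow> real) \<Rightarrow> bool" where
  "pseudodistance_on X d \<longleftrightarrow>
    (\<forall>x\<in>X. \<forall>y\<in>X. 0 \<le> d x y \<and> d x y = d y x) \<and> (\<forall>x\<in>X. d x x = 0) \<and>
    (\<forall>x\<in>X. \<forall>y\<in>X. \<forall>z\<in>X. d x z \<le> d x y + d y z)"

text \<open>
  The largest pseudodistance below the Lempert function is the pointwise supremum of all
  such pseudodistances; see \<open>kobayashi_greatest\<close>. On a domain the Lempert function is
  finite, so this is a supremum of a bounded set of reals. Values outside \<open>D\<close> are irrelevant.
\<close>

definition kobayashi :: "(complex ^ 'n) set \<Rightarrow> complex ^ 'n \<Rightarrow> complex ^ 'n \<Rightarrow> real" where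
  "kobayashi D z w =
    Sup {d z w | d. pseudodistance_on D d \<and> (\<forall>x\<in>D. \<forall>y\<in>D. ereal (d x y) \<le> lempert D x y)}"

definition gromov_product :: "('a \<Rightarrow> 'a \<Rightarrow> real) \<Rightarrow> 'a \<Rightarrow> 'a \<Rightarrow> 'a \<Rightarrow> real" where
  "gromov_product d x y z = d x z + d z y - d x y"

definition gromov_S :: "('a \<Rightarrow> 'a \<Rightarrow> real) \<Rightarrow> 'a \<Rightarrow> 'a \<Rightarrow> 'a \<Rightarrow> 'a \<Rightarrow> real" where
  "gromov_S d p q x w =
    min (gromov_product d p x w) (gromov_product d x q w) - gromov_product d p q w"

definition gromov_hyperbolic :: "'a set \<Rightarrow> ('a \<Rightarrow> 'a \<Rightarrow> real) \<Rightarrow> bool" where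
  "gromov_hyperbolic X d \<longleftrightarrow>
    (SUP (p, q, x, w) \<in> X \<times> X \<times> X \<times> X. ereal (gromov_S d p q x w)) < \<infinity>"

definition gromov_k_hyperbolic :: "(complex ^ 'n) set \<Rightarrow> bool" where
  "gromov_k_hyperbolic D \<longleftrightarrow> gromov_hyperbolic D (kobayashi D)"

text \<open>
  Below, \<open>C11_on\<close> is only used on neighbourhoods that may be shrunk, so it makes no difference
  whether the gradient is required to be Lipschitz or locally Lipschitz.
\<close>

definition C11_on :: "'a::real_inner set \<Rightarrow> ('a \<Rightarrow> real) \<Rightarrow> bool" where
  "C11_on U f \<longleftrightarrow> (\<exists>g L. (\<forall>x\<in>U. GDERIV f x :> g x) \<and> L-lipschitz_on U g)"

definition C11_smooth_domain :: "'a::real_inner set \<Rightarrow> bool" where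
  "C11_smooth_domain D \<longleftrightarrow> open D \<and> connected D \<and> D \<noteq> {} \<and>
    (\<forall>a \<in> frontier D. \<exists>U r. open U \<and> a \<in> U \<and> C11_on U r \<and>
       (\<forall>x\<in>U. \<not> GDERIV r x :> 0) \<and> D \<inter> U = {x \<in> U. r x < 0})"

definition log_ext :: "real \<Rightarrow> ereal" where
  "log_ext x = (if x > 0 then ereal (ln x) else -\<infinity>)"

lemma log_ext_quotient_zero:
  assumes "0 < x" "x < 1"
  shows "log_ext 0 / log_ext x = \<infinity>"
proof -
  have "inverse (ln x) < 0" using assms by simp
  then show ?thesis using assms by (simp add: log_ext_def divide_ereal_def)
qed

lemma kobayashi_greatest:
  fixes D :: "(complex ^ 'n) set"
  assumes fin: "\<And>z w. z \<in> D \<Longrightarrow> w \<in> D \<Longrightarrow> lempert D z w < \<infinity>"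
  shows "pseudodistance_on D (kobayashi D)"
    and "\<And>z w. z \<in> D \<Longrightarrow> w \<in> D \<Longrightarrow> ereal (kobayashi D z w) \<le> lempert D z w"
    and "\<And>d z w. pseudodistance_on D d \<Longrightarrow> (\<forall>x\<in>D. \<forall>y\<in>D. ereal (d x y) \<le> lempert D x y) \<Longrightarrow>
           z \<in> D \<Longrightarrow> w \<in> D \<Longrightarrow> d z w \<le> kobayashi D z w"
proof -
  define P where "P d \<longleftrightarrow> pseudodistance_on D d \<and>
    (\<forall>x\<in>D. \<forall>y\<in>D. ereal (d x y) \<le> lempert D x y)" for d :: "complex ^ 'n \<Rightarrow> complex ^ 'n \<Rightarrow> real"
  have k: "kobayashi D z w = Sup {d z w | d. P d}" for z w
    by (simp add: kobayashi_def P_def)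
  have lnn: "0 \<le> lempert D z w" for z w
    unfolding lempert_def by (rule Inf_greatest) (auto simp: artanh_def intro!: ln_ge_zero simp: divide_simps)
  have P0: "P (\<lambda>_ _. 0)"
    by (simp add: P_def pseudodistance_on_def lnn flip: zero_ereal_def)
  have real: "\<exists>l. lempert D z w = ereal l" if "z \<in> D" "w \<in> D" for z w
    using fin[OF that] lnn[of z w] by (cases "lempert D z w") auto
  have upper: "d z w \<le> kobayashi D z w" if dzw: "P d" "z \<in> D" "w \<in> D" for d z w
  proof -
    obtain l where "lempert D z w = ereal l" using real dzw by blast
    then have "bdd_above {d z w | d. P d}"
      using dzw by (intro bdd_aboveI[of _ l]) (force simp: P_def)
    then show ?thesis unfolding k using that by (intro cSup_upper) auto
  qed
  have least: "kobayashi D z w \<le> c" if "\<And>d. P d \<Longrightarrow> d z w \<le> c" for z w c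
    unfolding k using that P0 by (intro cSup_least) auto
  have sym_le: "kobayashi D x y \<le> kobayashi D y x" if xy: "x \<in> D" "y \<in> D" for x y
  proof (rule least)
    fix d assume d: "P d"
    then have "d x y = d y x" using xy by (simp add: P_def pseudodistance_on_def)
    then show "d x y \<le> kobayashi D y x" using upper[OF d, of y x] xy by simp
  qed
  have sym: "kobayashi D x y = kobayashi D y x" if "x \<in> D" "y \<in> D" for x y
    using sym_le[of x y] sym_le[of y x] that by simp
  have tri: "kobayashi D x z \<le> kobayashi D x y + kobayashi D y z"
    if "x \<in> D" "y \<in> D" "z \<in> D" for x y z
  proof (rule least)
    fix d assume d: "P d"
    then have "d x z \<le> d x y + d y z" using that by (simp add: P_def pseudodistance_on_def)
    then show "d x z \<le> kobayashi D x y + kobayashi D y z"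
      using upper[OF d, of x y] upper[OF d, of y z] that by linarith
  qed
  have nonneg: "0 \<le> kobayashi D x y" if "x \<in> D" "y \<in> D" for x y
    using upper[OF P0] that by blast
  have refl: "kobayashi D x x = 0" if "x \<in> D" for x
    using least[of x x 0] nonneg[of x x] that by (force simp: P_def pseudodistance_on_def)
  show "pseudodistance_on D (kobayashi D)"
    unfolding pseudodistance_on_def using nonneg sym refl tri by blast
  show "ereal (kobayashi D z w) \<le> lempert D z w" if zw: "z \<in> D" "w \<in> D" for z w
  proof -
    obtain l where l: "lempert D z w = ereal l" using real zw by blast
    have "kobayashi D z w \<le> l" using l zw by (intro least) (force simp: P_def)
    then show ?thesis by (simp add: l)
  qed
  show "d z w \<le> kobayashi D z w"
    if "pseudodistance_on D d" "\<forall>x\<in>D. \<forall>y\<in>D. ereal (d x y) \<le> lempert D x y" "z \<in> D" "w \<in> D"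
    for d z w
    using upper that by (simp add: P_def)
qed

end

theory Submission
  imports Defs
begin

text \<open>
  The domain is nearly a product at suitable scales near the origin, and a product of two
  hyperbolic directions is not Gromov hyperbolic: with the maximum metric it contains copies of
  large discs of the plane with the maximum norm. What has to be found is a place where \<open>D\<close> is
  close enough to a product for both upper and lower bounds on \<open>k\<^sub>D\<close>.

  Suppose \<open>D\<close> contains a bidisc \<open>{|z\<^sub>1 - (b/2 + e)| < e} \<times> {|z\<^sub>2| < s}\<close>, and take, with a large
  parameter \<open>k\<close> and after a rotation of \<open>z\<^sub>2\<close>,
  \<open>p = (b, 0)\<close>, \<open>q = (b, (1 - 1/k\<^sup>2) s)\<close>, \<open>x = (b, (1 - 1/k) s)\<close> and \<open>w = (k b, (1 - 1/k) s)\<close>.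
  The Poincare distance of the bidisc bounds each of \<open>k\<^sub>D(p,x)\<close>, \<open>k\<^sub>D(x,q)\<close>, \<open>k\<^sub>D(p,w)\<close>, \<open>k\<^sub>D(w,q)\<close>
  by \<open>ln (4 k) / 2\<close>. In the other direction, an affine function \<open>g\<close> with \<open>Re g > 0\<close> on \<open>D\<close> maps discs in
  \<open>D\<close> to discs in a half-plane, so \<open>k\<^sub>D\<close> of two points is at least half the difference of their
  values of \<open>ln (Re g)\<close>. The function \<open>z\<^sub>1\<close>
  gives \<open>k\<^sub>D(x,w) \<ge> ln k / 2\<close>. If some other \<open>g\<close> decreases from \<open>p\<close> to \<open>q\<close> by a factor of order
  \<open>k\<^sup>2\<close>, then \<open>k\<^sub>D(p,q) \<ge> ln k - O(1)\<close>, and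
  \<open>S(p,q,x,w) \<ge> k\<^sub>D(p,q) + k\<^sub>D(x,w) - ln (4 k) \<ge> ln k / 2 - O(1)\<close>.
  This is \<open>bidisc_corner_gromov_S\<close>. It remains to find, for arbitrarily large \<open>k\<close>, such a bidisc and
  such a \<open>g\<close>, and there are two cases.

  If \<open>\<psi> > 0\<close> on \<open>(0, \<epsilon>)\<close>, infinite order of vanishing makes the logarithmic derivative
  \<open>r \<psi>'(r) / \<psi>(r)\<close> unbounded near \<open>0\<close> (\<open>unbounded_log_derivative\<close>). Where it equals \<open>k\<^sup>2\<close>, take the
  bidisc of radius \<open>s = r\<close> at height \<open>b = 2 \<psi>(r)\<close> and for \<open>g\<close> the tangent plane of \<open>\<partial>D\<close> at
  \<open>(\<psi>(r), r)\<close> (\<open>tangent_gromov_S\<close>).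

  If \<open>\<psi>\<close> vanishes near \<open>0\<close>, the boundary contains a disc \<open>{0} \<times> {|z\<^sub>2| < \<rho>}\<close>; take \<open>\<rho>\<close> maximal.
  A point \<open>(0, \<zeta>)\<close> outside the closure of \<open>D\<close> with \<open>|\<zeta>|\<close> just above \<open>\<rho>\<close> can be separated from \<open>D\<close> by
  an affine \<open>g\<close>, which is almost zero at one point of the circle of radius \<open>\<rho>\<close>
  (\<open>flat_disc_gromov_S\<close>).
\<close>

section \<open>Lower bounds for the Kobayashi distance from half-planes\<close>

text \<open>
  This is the Harnack inequality for \<open>Re h\<close>. The Cayley transform based at \<open>h 0\<close> turns \<open>h\<close> into a
  self-map \<open>H\<close> of the disc fixing \<open>0\<close>, and the Schwarz lemma \<open>|H \<alpha>| \<le> |\<alpha>|\<close> translates back.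
\<close>

lemma half_plane_log_ratio_le_artanh:
  assumes hol: "h holomorphic_on ball 0 1"
    and pos: "\<And>\<zeta>. \<zeta> \<in> ball 0 1 \<Longrightarrow> 0 < Re (h \<zeta>)"
    and \<alpha>: "cmod \<alpha> < 1"
  shows "\<bar>ln (Re (h 0) / Re (h \<alpha>))\<bar> / 2 \<le> artanh (cmod \<alpha>)"
proof -
  define A where "A = h 0"
  define H where "H \<zeta> = (h \<zeta> - A) / (h \<zeta> + cnj A)" for \<zeta>
  have A: "0 < Re A" using pos[of 0] by (simp add: A_def)
  have nz: "h \<zeta> + cnj A \<noteq> 0" if "cmod \<zeta> < 1" for \<zeta>
  proof -
    have "0 < Re (h \<zeta> + cnj A)" using pos[of \<zeta>] A that by simp
    then show ?thesis by (metis less_irrefl zero_complex.sel(1))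
  qed
  have less: "cmod (H \<zeta>) < 1" if "cmod \<zeta> < 1" for \<zeta>
  proof -
    have "(cmod (h \<zeta> - A))\<^sup>2 < (cmod (h \<zeta> + cnj A))\<^sup>2"
    proof -
      have "(cmod (h \<zeta> + cnj A))\<^sup>2 - (cmod (h \<zeta> - A))\<^sup>2 = 4 * (Re (h \<zeta>) * Re A)"
        unfolding cmod_power2 by (simp add: power2_eq_square algebra_simps)
      moreover have "0 < Re (h \<zeta>) * Re A" using pos[of \<zeta>] A that by simp
      ultimately show ?thesis by linarith
    qed
    then have "cmod (h \<zeta> - A) < cmod (h \<zeta> + cnj A)"
      using power2_less_imp_less by fastforce
    then show ?thesis
      unfolding H_def norm_divide using nz[OF that] by (simp add: divide_less_eq)
  qed
  have holH: "H holomorphic_on ball 0 1"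
    unfolding H_def by (intro holomorphic_intros hol) (use nz in auto)
  have "cmod (H \<alpha>) \<le> cmod \<alpha>"
    by (rule Schwarz_Lemma(1)[OF holH _ less \<alpha>]) (simp_all add: H_def A_def)
  define r where "r = cmod (H \<alpha>)"
  have r: "0 \<le> r" "r \<le> cmod \<alpha>" "r < 1"
    using \<open>cmod (H \<alpha>) \<le> cmod \<alpha>\<close> \<alpha> by (auto simp: r_def)
  have H1: "H \<alpha> \<noteq> 1" using r r_def by auto
  have h_eq: "h \<alpha> = (A + cnj A * H \<alpha>) / (1 - H \<alpha>)"
  proof -
    have "H \<alpha> * (h \<alpha> + cnj A) = h \<alpha> - A" using nz[OF \<alpha>] by (simp add: H_def)
    then have "h \<alpha> * (1 - H \<alpha>) = A + cnj A * H \<alpha>" by (simp add: algebra_simps)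
    then show ?thesis using H1 by (simp add: field_simps)
  qed
  have Re_h: "Re (h \<alpha>) * (cmod (1 - H \<alpha>))\<^sup>2 = Re A * (1 - r\<^sup>2)"
  proof -
    have "h \<alpha> * of_real ((cmod (1 - H \<alpha>))\<^sup>2) = h \<alpha> * (1 - H \<alpha>) * cnj (1 - H \<alpha>)"
      by (simp add: complex_norm_square algebra_simps flip: of_real_power)
    also have "\<dots> = (A + cnj A * H \<alpha>) * cnj (1 - H \<alpha>)"
      using H1 by (simp add: h_eq)
    finally have "Re (h \<alpha> * of_real ((cmod (1 - H \<alpha>))\<^sup>2)) = Re ((A + cnj A * H \<alpha>) * cnj (1 - H \<alpha>))"
      by simp
    then show ?thesis
      by (simp add: r_def cmod_power2) (simp add: power2_eq_square algebra_simps)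
  qed
  define n where "n = cmod (1 - H \<alpha>)"
  have n: "1 - r \<le> n" "n \<le> 1 + r"
    using norm_triangle_ineq2[of 1 "H \<alpha>"] norm_triangle_ineq4[of 1 "H \<alpha>"] by (auto simp: n_def r_def)
  have B: "0 < Re (h \<alpha>)" using pos \<alpha> by simp
  have "Re (h \<alpha>) * (1 - r)\<^sup>2 \<le> Re (h \<alpha>) * n\<^sup>2"
    using n r B by (intro mult_left_mono power_mono) auto
  then have "(Re (h \<alpha>) * (1 - r)) * (1 - r) \<le> (Re A * (1 + r)) * (1 - r)"
    using Re_h by (simp add: n_def power2_eq_square algebra_simps)
  then have up: "Re (h \<alpha>) * (1 - r) \<le> Re A * (1 + r)"
    using r by (simp add: mult_le_cancel_right)
  have "Re (h \<alpha>) * n\<^sup>2 \<le> Re (h \<alpha>) * (1 + r)\<^sup>2"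
    using n r B by (intro mult_left_mono power_mono) auto
  then have "(Re A * (1 - r)) * (1 + r) \<le> (Re (h \<alpha>) * (1 + r)) * (1 + r)"
    using Re_h by (simp add: n_def power2_eq_square algebra_simps)
  then have lo: "Re A * (1 - r) \<le> Re (h \<alpha>) * (1 + r)"
    using r by (simp add: mult_le_cancel_right)
  define Q where "Q = (1 + r) / (1 - r)"
  have Q: "1 \<le> Q" "Re A / Re (h \<alpha>) \<le> Q" "Re (h \<alpha>) / Re A \<le> Q"
    using r A B up lo by (auto simp: Q_def field_simps)
  have "ln (Re A / Re (h \<alpha>)) \<le> ln Q" "ln (Re (h \<alpha>) / Re A) \<le> ln Q"
    using Q A B by (auto intro!: ln_mono)
  then have "\<bar>ln (Re A / Re (h \<alpha>))\<bar> \<le> ln Q"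
    using A B by (simp add: ln_div abs_le_iff)
  also have "ln Q \<le> ln ((1 + cmod \<alpha>) / (1 - cmod \<alpha>))"
    using r \<alpha> Q(1) unfolding Q_def by (intro ln_mono frac_le) (auto simp: field_simps)
  finally show ?thesis by (simp add: artanh_def A_def)
qed

text \<open>
  The pseudodistances whose supremum is the Kobayashi distance.
\<close>

definition below_lempert :: "(complex ^ 'n) set \<Rightarrow> (complex ^ 'n \<Rightarrow> complex ^ 'n \<Rightarrow> real) \<Rightarrow> bool" where
  "below_lempert D d \<longleftrightarrow>
    pseudodistance_on D d \<and> (\<forall>x\<in>D. \<forall>y\<in>D. ereal (d x y) \<le> lempert D x y)"

lemma lempert_nonneg: "0 \<le> lempert D z w"
  unfolding lempert_def
  by (rule Inf_greatest) (auto simp: artanh_def intro!: ln_ge_zero simp: divide_simps)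

lemma kobayashi_le:
  assumes "z \<in> D" "w \<in> D" "lempert D z w \<le> ereal M"
  shows "kobayashi D z w \<le> M"
  unfolding kobayashi_def
proof (rule cSup_least)
  have "pseudodistance_on D (\<lambda>_ _. 0) \<and> (\<forall>x\<in>D. \<forall>y\<in>D. ereal 0 \<le> lempert D x y)"
    by (simp add: pseudodistance_on_def lempert_nonneg flip: zero_ereal_def)
  then show "{d z w | d. pseudodistance_on D d \<and>
      (\<forall>x\<in>D. \<forall>y\<in>D. ereal (d x y) \<le> lempert D x y)} \<noteq> {}" by blast
  fix t assume "t \<in> {d z w | d. pseudodistance_on D d \<and>
      (\<forall>x\<in>D. \<forall>y\<in>D. ereal (d x y) \<le> lempert D x y)}"
  then have "ereal t \<le> lempert D z w" using assms by blast
  then show "t \<le> M" using assms(3) by (metis ereal_less_eq(3) order_trans)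
qed

text \<open>
  Finiteness of the Lempert function at the one pair \<open>z\<close>, \<open>w\<close> makes the supremum that defines
  \<open>kobayashi D z w\<close> a bounded one.
\<close>

lemma kobayashi_ge:
  assumes "z \<in> D" "w \<in> D" "lempert D z w < \<infinity>" "below_lempert D d"
  shows "d z w \<le> kobayashi D z w"
  unfolding kobayashi_def
proof (rule cSup_upper)
  obtain M where M: "lempert D z w = ereal M"
    using assms(3) lempert_nonneg[of D z w] by (cases "lempert D z w") auto
  show "bdd_above {d z w | d. pseudodistance_on D d \<and>
      (\<forall>x\<in>D. \<forall>y\<in>D. ereal (d x y) \<le> lempert D x y)}"
    using assms(1,2) M by (intro bdd_aboveI[of _ M]) force
qed (use assms(4) in \<open>auto simp: below_lempert_def\<close>)

text \<open>
  An affine function with positive real part sends every analytic disc in \<open>D\<close> to one in the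
  right half-plane, where the Harnack inequality applies. Through such functions every supporting
  hyperplane of a convex domain gives a lower bound for its Kobayashi distance.
\<close>

lemma log_ratio_below_lempert:
  fixes D :: "(complex ^ 2) set"
  assumes pos: "\<And>z. z \<in> D \<Longrightarrow> 0 < Re (\<mu> * z $ 1 + \<nu> * z $ 2 + \<gamma>)"
  shows "below_lempert D (\<lambda>z w. \<bar>ln (Re (\<mu> * z $ 1 + \<nu> * z $ 2 + \<gamma>)
    / Re (\<mu> * w $ 1 + \<nu> * w $ 2 + \<gamma>))\<bar> / 2)"
proof -
  define g where "g z = \<mu> * z $ 1 + \<nu> * z $ 2 + \<gamma>" for z :: "complex ^ 2"
  have pos: "0 < Re (g z)" if "z \<in> D" for z using pos[OF that] by (simp add: g_def)
  have "pseudodistance_on D (\<lambda>z w. \<bar>ln (Re (g z) / Re (g w))\<bar> / 2)"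
  proof -
    have "ln (Re (g z) / Re (g w)) = ln (Re (g z)) - ln (Re (g w))" if "z \<in> D" "w \<in> D" for z w
      using pos[OF that(1)] pos[OF that(2)] by (simp add: ln_div)
    then show ?thesis unfolding pseudodistance_on_def by auto
  qed
  moreover have "ereal (\<bar>ln (Re (g z) / Re (g w))\<bar> / 2) \<le> lempert D z w" for z w
    unfolding lempert_def
  proof (rule Inf_greatest, clarify)
    fix \<alpha> :: complex and \<phi> :: "complex \<Rightarrow> complex ^ 2"
    assume \<alpha>: "\<alpha> \<in> ball 0 1" and hol: "\<forall>i. (\<lambda>\<zeta>. \<phi> \<zeta> $ i) holomorphic_on ball 0 1"
      and im: "\<phi> ` ball 0 1 \<subseteq> D"
    have "(\<lambda>\<zeta>. g (\<phi> \<zeta>)) holomorphic_on ball 0 1"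
      unfolding g_def using hol by (intro holomorphic_intros) auto
    then show "ereal (\<bar>ln (Re (g (\<phi> 0)) / Re (g (\<phi> \<alpha>)))\<bar> / 2) \<le> ereal (artanh (cmod \<alpha>))"
      using half_plane_log_ratio_le_artanh[of "\<lambda>\<zeta>. g (\<phi> \<zeta>)" \<alpha>] pos im \<alpha>
      by (simp add: image_subset_iff)
  qed
  ultimately show ?thesis by (simp add: below_lempert_def g_def)
qed

lemma kobayashi_ge_log_ratio:
  fixes D :: "(complex ^ 2) set"
  assumes "\<And>z. z \<in> D \<Longrightarrow> 0 < Re (\<mu> * z $ 1 + \<nu> * z $ 2 + \<gamma>)"
    and "z \<in> D" "w \<in> D" "lempert D z w < \<infinity>"
  shows "\<bar>ln (Re (\<mu> * z $ 1 + \<nu> * z $ 2 + \<gamma>) / Re (\<mu> * w $ 1 + \<nu> * w $ 2 + \<gamma>))\<bar> / 2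
    \<le> kobayashi D z w"
  by (rule kobayashi_ge[OF assms(2-4) log_ratio_below_lempert[OF assms(1)]])

section \<open>Upper bounds from embedded bidiscs\<close>

text \<open>
  The hypothesis says that the pseudohyperbolic distance of \<open>a\<close> and \<open>u\<close> is at most \<open>\<alpha>\<close>. The map is
  the Moebius transformation moving \<open>0\<close> to \<open>a\<close>, precomposed with a contraction that slows it
  down so that it arrives at \<open>u\<close> exactly at time \<open>\<alpha>\<close>. Slowing down is what allows two coordinates
  with different distances to be joined by one disc.
\<close>

lemma disc_through_real_points:
  fixes a u \<alpha> :: real
  assumes a: "\<bar>a\<bar> < 1" and u: "\<bar>u\<bar> < 1" and \<alpha>: "0 \<le> \<alpha>" "\<alpha> < 1"
    and le: "\<bar>u - a\<bar> \<le> \<alpha> * (1 - a * u)"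
  obtains f where "f holomorphic_on ball 0 1" "f ` ball 0 1 \<subseteq> ball 0 1"
    "f 0 = of_real a" "f (of_real \<alpha>) = of_real u"
proof -
  \<comment> \<open>For \<open>\<alpha> = 0\<close> the points coincide, and the value \<open>t = 0\<close> of the quotient gives the constant disc.\<close>
  define t where "t = (u - a) / ((1 - a * u) * \<alpha>)"
  define f :: "complex \<Rightarrow> complex" where
    "f \<zeta> = (of_real t * \<zeta> + of_real a) / (1 + of_real a * (of_real t * \<zeta>))" for \<zeta>
  have au: "0 < 1 - a * u"
  proof -
    have "\<bar>a * u\<bar> < 1" using a u mult_strict_mono'[of "\<bar>a\<bar>" 1 "\<bar>u\<bar>" 1] by (simp add: abs_mult)
    then show ?thesis by linarith
  qed
  have t: "\<bar>t\<bar> \<le> 1"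
    using le au \<alpha> by (cases "\<alpha> = 0") (auto simp: t_def abs_mult divide_le_eq mult.commute)
  have t\<alpha>: "t * \<alpha> = (u - a) / (1 - a * u)"
    using le au \<alpha> by (cases "\<alpha> = 0") (auto simp: t_def)
  have arg: "cmod (of_real t * \<zeta>) < 1" if "cmod \<zeta> < 1" for \<zeta>
    using t that by (simp add: norm_mult) (meson abs_ge_zero le_less_trans mult_left_le_one_le norm_ge_zero)
  have f_eq: "f = (\<lambda>\<zeta>. Moebius_function 0 (- of_real a) (of_real t * \<zeta>))"
    by (auto simp: f_def Moebius_function_def)
  show ?thesis
  proof
    have "(Moebius_function 0 (- of_real a) \<circ> (\<lambda>\<zeta>. of_real t * \<zeta>)) holomorphic_on ball 0 1"
      by (rule holomorphic_on_compose_gen[OF _ Moebius_function_holomorphic])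
         (use a arg in \<open>auto intro!: holomorphic_intros\<close>)
    then show "f holomorphic_on ball 0 1" by (simp add: f_eq o_def)
    show "f ` ball 0 1 \<subseteq> ball 0 1"
      unfolding f_eq using a arg by (auto intro!: Moebius_function_norm_lt_1)
    show "f 0 = of_real a" by (simp add: f_def)
    have "f (of_real \<alpha>) = of_real ((t * \<alpha> + a) / (1 + a * (t * \<alpha>)))"
      by (simp add: f_def)
    also have "(t * \<alpha> + a) / (1 + a * (t * \<alpha>)) = u"
    proof -
      have "a\<^sup>2 < 1" using a by (simp add: abs_square_less_1)
      then have "1 - a\<^sup>2 \<noteq> 0" by simp
      have 1: "t * \<alpha> + a = u * (1 - a\<^sup>2) / (1 - a * u)"
        unfolding t\<alpha> using au by (simp add: field_simps power2_eq_square)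
      have 2: "1 + a * (t * \<alpha>) = (1 - a\<^sup>2) / (1 - a * u)"
        unfolding t\<alpha> using au by (simp add: field_simps power2_eq_square)
      show ?thesis unfolding 1 2 using au \<open>1 - a\<^sup>2 \<noteq> 0\<close> by simp
    qed
    finally show "f (of_real \<alpha>) = of_real u" .
  qed
qed

text \<open>
  The distance in a bidisc is the maximum of the distances in the two factors. The Poincare
  distance of \<open>a < u\<close> is half the logarithm of the cross ratio \<open>(1 + u) (1 - a) / ((1 - u) (1 + a))\<close>,
  so the hypotheses bound these cross ratios, in both orders, by \<open>M\<close>.
\<close>

lemma lempert_bidisc_le:
  fixes D :: "(complex ^ 2) set" and c a u b v R S M :: real
  assumes box: "\<And>z. cmod (z $ 1 - of_real c) < R \<Longrightarrow> cmod (z $ 2) < S \<Longrightarrow> z \<in> D"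
    and "0 < R" "0 < S" and \<theta>: "cmod \<theta> = 1" and "1 \<le> M"
    and "\<bar>a\<bar> < 1" "\<bar>u\<bar> < 1" "\<bar>b\<bar> < 1" "\<bar>v\<bar> < 1"
    and cross: "(1 + u) * (1 - a) \<le> M * ((1 - u) * (1 + a))" "(1 + a) * (1 - u) \<le> M * ((1 - a) * (1 + u))"
      "(1 + v) * (1 - b) \<le> M * ((1 - v) * (1 + b))" "(1 + b) * (1 - v) \<le> M * ((1 - b) * (1 + v))"
  shows "lempert D (vector [of_real (c + R * a), of_real (S * b) * \<theta>])
    (vector [of_real (c + R * u), of_real (S * v) * \<theta>]) \<le> ereal (ln M / 2)"
proof -
  \<comment> \<open>\<open>\<alpha>\<close> is the pseudohyperbolic distance corresponding to the cross ratio \<open>M\<close>.\<close>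
  define \<alpha> where "\<alpha> = (M - 1) / (M + 1)"
  have \<alpha>: "0 \<le> \<alpha>" "\<alpha> < 1" using \<open>1 \<le> M\<close> by (auto simp: \<alpha>_def)
  have art: "artanh \<alpha> = ln M / 2"
  proof -
    have "(1 + \<alpha>) / (1 - \<alpha>) = M" using \<open>1 \<le> M\<close> by (simp add: \<alpha>_def divide_simps)
    then show ?thesis by (simp add: artanh_def)
  qed
  have "\<bar>u - a\<bar> \<le> \<alpha> * (1 - a * u)" "\<bar>v - b\<bar> \<le> \<alpha> * (1 - b * v)"
    using cross \<open>1 \<le> M\<close> by (auto simp: \<alpha>_def field_simps abs_le_iff)
  then obtain f g where
    f: "f holomorphic_on ball 0 1" "f ` ball 0 1 \<subseteq> ball 0 1" "f 0 = of_real a" "f (of_real \<alpha>) = of_real u" and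
    g: "g holomorphic_on ball 0 1" "g ` ball 0 1 \<subseteq> ball 0 1" "g 0 = of_real b" "g (of_real \<alpha>) = of_real v"
    using disc_through_real_points[of a u \<alpha>] disc_through_real_points[of b v \<alpha>] assms \<alpha> by metis
  define \<phi> :: "complex \<Rightarrow> complex ^ 2" where
    "\<phi> \<zeta> = vector [of_real c + of_real R * f \<zeta>, of_real S * g \<zeta> * \<theta>]" for \<zeta>
  have "(\<lambda>\<zeta>. \<phi> \<zeta> $ i) holomorphic_on ball 0 1" for i
  proof (cases "i = 1")
    case True
    then show ?thesis by (simp add: \<phi>_def) (intro holomorphic_intros f)
  next
    case False
    then have "i = 2" using exhaust_2 by blast
    then show ?thesis by (simp add: \<phi>_def) (intro holomorphic_intros g)
  qed
  moreover have "\<phi> ` ball 0 1 \<subseteq> D"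
  proof clarify
    fix \<zeta> :: complex assume "\<zeta> \<in> ball 0 1"
    then have "cmod (f \<zeta>) < 1" "cmod (g \<zeta>) < 1" using f(2) g(2) by (auto simp: image_subset_iff)
    then show "\<phi> \<zeta> \<in> D"
      using \<open>0 < R\<close> \<open>0 < S\<close> \<theta> by (intro box) (auto simp: \<phi>_def norm_mult)
  qed
  moreover have "\<phi> 0 = vector [of_real (c + R * a), of_real (S * b) * \<theta>]"
    "\<phi> (of_real \<alpha>) = vector [of_real (c + R * u), of_real (S * v) * \<theta>]"
    using f g by (auto simp: \<phi>_def)
  moreover have "of_real \<alpha> \<in> ball (0::complex) 1" using \<alpha> by simp
  moreover have "artanh (cmod (of_real \<alpha>)) = ln M / 2" using art \<alpha> by simp
  ultimately show ?thesis
    unfolding lempert_def by (intro Inf_lower CollectI) metis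
qed

section \<open>Four points near the corner of a bidisc\<close>

text \<open>
  In logarithmic coordinates \<open>(ln (Re z\<^sub>1), ln (s / (s - |z\<^sub>2|)))\<close> the distance is close to half the
  maximum norm. There \<open>p\<close>, \<open>x\<close>, \<open>q\<close> lie at \<open>0\<close>, \<open>ln k\<close>, \<open>2 ln k\<close> on a line in the second direction, and
  \<open>w\<close> is \<open>x\<close> moved by \<open>ln k\<close> in the first direction. In the maximum norm \<open>w\<close> is as close to
  \<open>p\<close> and \<open>q\<close> as the midpoint \<open>x\<close> is, although it is far from \<open>x\<close>; for unbounded \<open>k\<close> no hyperbolic space allows this.

  The assumption \<open>supp\<close> with \<open>far\<close> rules out shortcuts between \<open>p\<close> and \<open>q\<close> that leave the bidisc, and
  the bidisc starts at height \<open>b/2\<close> so that \<open>b\<close> is at bounded distance from its boundary in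
  the logarithmic scale. The height of \<open>w\<close> stays below the centre of the disc since \<open>k b \<le> e\<close>.
\<close>

lemma bidisc_corner_gromov_S:
  fixes D :: "(complex ^ 2) set" and k b e s C :: real
  assumes k: "1 \<le> k" and b: "0 < b" and kb: "k * b \<le> e" and s: "0 < s"
    and \<theta>: "cmod \<theta> = 1" and C: "0 < C"
    and box: "\<And>z. cmod (z $ 1 - of_real (b / 2 + e)) < e \<Longrightarrow> cmod (z $ 2) < s \<Longrightarrow> z \<in> D"
    and right: "\<And>z. z \<in> D \<Longrightarrow> 0 < Re (z $ 1)"
    and supp: "\<And>z. z \<in> D \<Longrightarrow> 0 < Re (\<mu> * z $ 1 + \<nu> * z $ 2 + \<gamma>)"
    and far: "k\<^sup>2 * Re (\<mu> * of_real b + \<nu> * (of_real (s * (1 - 1 / k\<^sup>2)) * \<theta>) + \<gamma>)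
      \<le> C * Re (\<mu> * of_real b + \<gamma>)"
  shows "\<exists>p\<in>D. \<exists>q\<in>D. \<exists>x\<in>D. \<exists>w\<in>D. ln (k / (16 * C)) / 2 \<le> gromov_S (kobayashi D) p q x w"
proof -
  define P :: "real \<Rightarrow> real \<Rightarrow> complex ^ 2"
    where "P t v = vector [of_real t, of_real (s * v) * \<theta>]" for t v
  have be: "b \<le> e" using kb k b mult_right_mono[of 1 k b] by linarith
  have e: "0 < e" using be b by linarith
  have in_D: "P t v \<in> D" if "b \<le> t" "t \<le> k * b" "0 \<le> v" "v < 1" for t v
  proof (rule box)
    have "\<bar>t - (b / 2 + e)\<bar> < e" using that kb b be by (simp add: abs_less_iff)
    moreover have "cmod (of_real t - of_real (b / 2 + e)) = \<bar>t - (b / 2 + e)\<bar>"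
      by (metis norm_of_real of_real_diff)
    ultimately show "cmod (P t v $ 1 - of_real (b / 2 + e)) < e" by (simp add: P_def)
    show "cmod (P t v $ 2) < s" using that s \<theta> by (simp add: P_def norm_mult)
  qed
  have upper: "lempert D (P t v) (P t' v') \<le> ereal (ln (4 * K) / 2)"
    if t: "b \<le> t" "t \<le> k * b" "b \<le> t'" "t' \<le> k * b" and v: "0 \<le> v" "v < 1" "0 \<le> v'" "v' < 1"
      and K: "k \<le> K" and vv': "1 - v \<le> K * (1 - v')" "1 - v' \<le> K * (1 - v)" for t v t' v' K
  proof -
    \<comment> \<open>The position of the height \<open>y\<close> after the first factor is normalised to the unit disc.\<close>
    define a where "a y = (y - (b / 2 + e)) / e" for y
    have a_eq: "b / 2 + e + e * a y = y" for y using e by (simp add: a_def)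
    have a1: "1 + a y = (y - b / 2) / e" and a2: "1 - a y = (b / 2 + 2 * e - y) / e" for y
      using e by (auto simp: a_def field_simps)
    have abs_a: "\<bar>a y\<bar> < 1" if "b \<le> y" "y \<le> k * b" for y
      using that kb b be e by (simp add: a_def abs_less_iff field_simps)
    have K1: "1 \<le> K" using K k by simp
    have height: "(1 + a y') * (1 - a y) \<le> 4 * K * ((1 - a y') * (1 + a y))"
      if "b \<le> y" "y \<le> k * b" "b \<le> y'" "y' \<le> k * b" for y y'
    proof -
      have "y' \<le> k * b" by fact
      also have "\<dots> \<le> k * (2 * (y - b / 2))" using that k by (intro mult_left_mono) auto
      also have "\<dots> \<le> K * (2 * (y - b / 2))" using that b K by (intro mult_right_mono) auto
      finally have 1: "y' - b / 2 \<le> 2 * K * (y - b / 2)" using b by (simp add: algebra_simps)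
      have 2: "b / 2 + 2 * e - y \<le> 2 * (b / 2 + 2 * e - y')" using that kb b by simp
      have "(y' - b / 2) * (b / 2 + 2 * e - y) \<le> (2 * K * (y - b / 2)) * (2 * (b / 2 + 2 * e - y'))"
        using that kb b e K1 by (intro mult_mono 1 2) auto
      also have "\<dots> = 4 * K * ((b / 2 + 2 * e - y') * (y - b / 2))" by (simp add: algebra_simps)
      finally show ?thesis using e by (simp add: a1 a2 divide_simps)
    qed
    have radial: "(1 + y') * (1 - y) \<le> 4 * K * ((1 - y') * (1 + y))"
      if "0 \<le> y" "y < 1" "0 \<le> y'" "y' < 1" "1 - y \<le> K * (1 - y')" for y y'
    proof -
      have "(1 + y') * (1 - y) \<le> (4 * (1 + y)) * (K * (1 - y'))"
        using that by (intro mult_mono) auto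
      then show ?thesis by (simp add: algebra_simps)
    qed
    have "lempert D (vector [of_real (b / 2 + e + e * a t), of_real (s * v) * \<theta>])
      (vector [of_real (b / 2 + e + e * a t'), of_real (s * v') * \<theta>]) \<le> ereal (ln (4 * K) / 2)"
      by (rule lempert_bidisc_le[OF box e s \<theta> _ abs_a abs_a _ _ height height radial radial])
         (use t v vv' K1 in auto)
    then show ?thesis by (simp only: a_eq P_def)
  qed
  define k2 where "k2 = 1 - 1 / k\<^sup>2"
  define k1 where "k1 = 1 - 1 / k"
  have kk: "k \<le> k\<^sup>2" using k by (simp add: power2_eq_square)
  have bkb: "b \<le> k * b" using k b by simp
  have k12: "0 \<le> k1" "k1 < 1" "0 \<le> k2" "k2 < 1" "1 - k1 = 1 / k" "1 - k2 = 1 / k\<^sup>2"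
    using k kk by (auto simp: k1_def k2_def)
  define p q x w where "p = P b 0" and "q = P b k2" and "x = P b k1" and "w = P (k * b) k1"
  have D: "p \<in> D" "q \<in> D" "x \<in> D" "w \<in> D"
    unfolding p_def q_def x_def w_def using bkb k12 by (auto intro!: in_D)
  have side: "kobayashi D (P t v) (P t' v') \<le> ln (4 * k) / 2"
    if "t \<in> {b, k * b}" "t' \<in> {b, k * b}" "(v, v') \<in> {(0, k1), (k1, k2), (k1, k1), (k2, k1)}" for t v t' v'
  proof -
    have K: "1 - k2 \<le> k * (1 - k1)" "1 - k1 \<le> k * (1 - k2)" "1 - k1 \<le> k * (1 - k1)"
      "1 \<le> k * (1 - k1)" "1 - k1 \<le> k"
      unfolding k12(5,6) using k kk one_le_power[OF k, of 2]
      by (auto simp: power2_eq_square field_simps)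
    have "0 \<le> v \<and> v < 1 \<and> 0 \<le> v' \<and> v' < 1 \<and> 1 - v \<le> k * (1 - v') \<and> 1 - v' \<le> k * (1 - v)"
      using that(3) k12(1-4) K by (elim insertE) auto
    then show ?thesis
      using that(1,2) bkb by (intro kobayashi_le in_D upper) auto
  qed
  \<comment> \<open>The bound for \<open>p, q\<close> is a cruder one, with \<open>k\<^sup>2\<close> in place of \<open>k\<close>; only finiteness matters.\<close>
  have finite: "lempert D p q < \<infinity>" "lempert D w x < \<infinity>" "lempert D x w < \<infinity>"
  proof -
    have "lempert D p q \<le> ereal (ln (4 * k\<^sup>2) / 2)"
      unfolding p_def q_def using bkb k12 k kk by (intro upper) (auto simp: divide_le_eq_1)
    then show "lempert D p q < \<infinity>" using le_less_trans by fastforce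
    have "lempert D w x \<le> ereal (ln (4 * k) / 2)" "lempert D x w \<le> ereal (ln (4 * k) / 2)"
      unfolding w_def x_def using bkb k12 k by (auto intro!: upper)
    then show "lempert D w x < \<infinity>" "lempert D x w < \<infinity>" using le_less_trans by fastforce+
  qed
  have pq: "ln (k\<^sup>2 / C) / 2 \<le> kobayashi D p q"
  proof -
    define gp where "gp = Re (\<mu> * p $ 1 + \<nu> * p $ 2 + \<gamma>)"
    define gq where "gq = Re (\<mu> * q $ 1 + \<nu> * q $ 2 + \<gamma>)"
    have pos: "0 < gp" "0 < gq" using supp D by (auto simp: gp_def gq_def)
    have "k\<^sup>2 * gq \<le> C * gp" using far by (simp add: gp_def gq_def p_def q_def P_def k2_def)
    then have "k\<^sup>2 / C \<le> gp / gq" using pos C by (simp add: field_simps)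
    then have "ln (k\<^sup>2 / C) \<le> ln (gp / gq)" using k C by (intro ln_mono) auto
    then show ?thesis
      using kobayashi_ge_log_ratio[OF supp D(1,2) finite(1)] by (simp add: gp_def gq_def)
  qed
  have wx: "ln k / 2 \<le> kobayashi D w x" and xw: "ln k / 2 \<le> kobayashi D x w"
    using kobayashi_ge_log_ratio[of D 1 0 0 w x] kobayashi_ge_log_ratio[of D 1 0 0 x w]
      right D(3,4) finite(2,3) b k
    by (simp_all add: w_def x_def P_def ln_div)
  have sides: "kobayashi D p w \<le> ln (4 * k) / 2" "kobayashi D p x \<le> ln (4 * k) / 2"
    "kobayashi D x q \<le> ln (4 * k) / 2" "kobayashi D w q \<le> ln (4 * k) / 2"
    unfolding p_def q_def x_def w_def by (rule side; simp)+
  have "ln (k / (16 * C)) / 2 = ln (k\<^sup>2 / C) / 2 + ln k / 2 - ln (4 * k) / 2 - ln (4 * k) / 2"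
  proof -
    have "ln (16::real) = 2 * ln 4" using ln_realpow[of "4::real" 2] by simp
    then show ?thesis using k C by (simp add: ln_div ln_mult ln_realpow)
  qed
  also have "\<dots> \<le> gromov_S (kobayashi D) p q x w"
    unfolding gromov_S_def gromov_product_def min_def using pq wx xw sides by auto
  finally show ?thesis using D by blast
qed

section \<open>Supporting hyperplanes of convex domains\<close>

lemma closure_approached_from_right:
  fixes D :: "(complex ^ 2) set" and a \<eta> :: real
  assumes "0 < \<eta>" and in_D: "\<And>t. 0 < t \<Longrightarrow> t < \<eta> \<Longrightarrow> vector [of_real (a + t), \<zeta>] \<in> D"
  shows "vector [of_real a, \<zeta>] \<in> closure D"
proof (rule closure_sequential[THEN iffD2], intro exI conjI allI)
  define t where "t n = \<eta> / (real n + 2)" for n :: nat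
  define f :: "nat \<Rightarrow> complex ^ 2" where "f n = vector [of_real (a + t n), \<zeta>]" for n
  show "f n \<in> D" for n
    unfolding f_def using \<open>0 < \<eta>\<close> by (intro in_D) (auto simp: t_def divide_less_eq)
  show "f \<longlonglongrightarrow> vector [of_real a, \<zeta>]"
  proof (rule vec_tendstoI)
    fix i :: 2
    have "(\<lambda>n. a + t n) \<longlonglongrightarrow> a" unfolding t_def by real_asymp
    then have "(\<lambda>n. complex_of_real (a + t n)) \<longlonglongrightarrow> of_real a" by (rule tendsto_of_real)
    then show "(\<lambda>n. f n $ i) \<longlonglongrightarrow> (vector [of_real a, \<zeta>] :: complex ^ 2) $ i"
      using exhaust_2[of i] by (auto simp: f_def simp del: of_real_add)
  qed
qed

lemma open_bidisc: "open {z :: complex ^ 2. cmod (z $ 1) < \<delta> \<and> cmod (z $ 2) < \<delta>}"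
  by (intro open_Collect_conj open_Collect_less continuous_intros)

text \<open>
  For a convex set, a hyperplane that supports it near one boundary point \<open>y\<close> supports it globally:
  the segment from \<open>y\<close> to a point \<open>z\<close> of \<open>D\<close> enters \<open>V\<close> inside \<open>D\<close>, and an affine function
  vanishing at \<open>y\<close> has constant sign along that segment.
\<close>

lemma convex_local_support_imp_positive:
  fixes D V :: "(complex ^ 2) set" and y z :: "complex ^ 2"
  assumes "convex D" "open D" "open V" "y \<in> V" "y \<in> closure D"
    and y: "Re (\<mu> * y $ 1 + \<nu> * y $ 2 + \<gamma>) = 0"
    and loc: "\<And>z. z \<in> D \<inter> V \<Longrightarrow> 0 < Re (\<mu> * z $ 1 + \<nu> * z $ 2 + \<gamma>)"
    and z: "z \<in> D"
  shows "0 < Re (\<mu> * z $ 1 + \<nu> * z $ 2 + \<gamma>)"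
proof (cases "z = y")
  case True
  then show ?thesis using loc z \<open>y \<in> V\<close> by blast
next
  case False
  define u where "u t = (1 - t) *\<^sub>R y + t *\<^sub>R z" for t
  have "continuous (at_right 0) u" unfolding u_def by (intro continuous_intros)
  then have "(u \<longlongrightarrow> y) (at_right 0)" by (simp add: continuous_within u_def)
  then have "\<forall>\<^sub>F t in at_right 0. u t \<in> V" using \<open>open V\<close> \<open>y \<in> V\<close> by (rule topological_tendstoD)
  moreover have "\<forall>\<^sub>F t::real in at_right 0. 0 < t \<and> t < 1"
    by (auto simp: eventually_at_right_field intro!: exI[of _ 1])
  ultimately have "\<forall>\<^sub>F t in at_right 0. u t \<in> V \<and> 0 < t \<and> t < 1" by eventually_elim auto
  then obtain t where t: "u t \<in> V" "0 < t" "t < 1"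
    using eventually_happens trivial_limit_at_right_real by blast
  have "open_segment z y \<subseteq> D"
    using in_interior_closure_convex_segment[of D z y] assms by (simp add: interior_open)
  moreover have "u t \<in> open_segment z y"
    using t False by (auto simp: in_segment u_def algebra_simps intro!: exI[of _ "1 - t"])
  ultimately have "0 < Re (\<mu> * u t $ 1 + \<nu> * u t $ 2 + \<gamma>)" using loc t(1) by blast
  also have "Re (\<mu> * u t $ 1 + \<nu> * u t $ 2 + \<gamma>)
    = (1 - t) * Re (\<mu> * y $ 1 + \<nu> * y $ 2 + \<gamma>) + t * Re (\<mu> * z $ 1 + \<nu> * z $ 2 + \<gamma>)"
    by (simp add: u_def algebra_simps)
  finally show ?thesis using y t(2) by (simp add: zero_less_mult_iff)
qed

lemma norm_le_cmod_add: "norm z \<le> cmod (z $ 1) + cmod (z $ 2)" for z :: "complex ^ 2"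
  unfolding norm_vec_def using L2_set_le_sum[of UNIV "\<lambda>i. norm (z $ i)"] by (simp add: sum_2)

section \<open>Flat boundary points\<close>

text \<open>
  The disc \<open>{0} \<times> {|\<zeta>| < \<rho>}\<close> is the largest one centred at the origin in the closure of \<open>D\<close>. By its maximality
  some \<open>(0, \<zeta>)\<close> with \<open>|\<zeta>| < \<rho> (1 + k\<^sup>-\<^sup>2)\<close> can be separated from \<open>D\<close>. The separating affine
  function \<open>g\<close> is nonnegative on the disc and vanishes at \<open>(0, \<zeta>)\<close>, so in the direction \<open>\<theta>\<close> of its
  steepest descent it drops from about \<open>n \<rho>\<close> at the centre to \<open>O(n \<rho> k\<^sup>-\<^sup>2)\<close> at the point \<open>q\<close>, which has
  distance \<open>O(\<rho> k\<^sup>-\<^sup>2)\<close> from the circle. Convexity supplies the bidisc: shrinking the flat disc by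
  the factor \<open>1 - k\<^sup>-\<^sup>2\<close> leaves room for \<open>k\<^sup>-\<^sup>2\<close> times the half-disc \<open>{Re z\<^sub>1 > 0}\<close> in the first coordinate.
\<close>

lemma flat_disc_gromov_S:
  fixes D :: "(complex ^ 2) set" and \<delta> k :: real
  assumes D: "convex D" "open D" "bounded D" and \<delta>: "0 < \<delta>" and k: "1 < k"
    and local: "\<And>z. 0 < Re (z $ 1) \<Longrightarrow> cmod (z $ 1) < \<delta> \<Longrightarrow> cmod (z $ 2) < \<delta> \<Longrightarrow> z \<in> D"
    and right: "\<And>z. z \<in> D \<Longrightarrow> 0 < Re (z $ 1)"
  shows "\<exists>p\<in>D. \<exists>q\<in>D. \<exists>x\<in>D. \<exists>w\<in>D. ln (k / (16 * 8)) / 2 \<le> gromov_S (kobayashi D) p q x w"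
proof -
  define E where "E = {r. 0 \<le> r \<and> (\<forall>\<zeta>. cmod \<zeta> < r \<longrightarrow> vector [0, \<zeta>] \<in> closure D)}"
  define \<rho> where "\<rho> = Sup E"
  have \<delta>E: "\<delta> \<in> E"
  proof -
    have "vector [of_real 0, \<zeta>] \<in> closure D" if "cmod \<zeta> < \<delta>" for \<zeta>
    proof (rule closure_approached_from_right[OF \<delta>])
      fix t assume "0 < t" "t < \<delta>"
      then show "vector [of_real (0 + t), \<zeta>] \<in> D" using that by (intro local) simp_all
    qed
    then show ?thesis using \<delta> by (simp add: E_def)
  qed
  obtain B where B: "\<And>z. z \<in> closure D \<Longrightarrow> norm z \<le> B"
    using bounded_closure[OF D(3)] unfolding bounded_iff by blast
  have bdd: "bdd_above E"
  proof (rule bdd_aboveI[of _ "2 * B + 2"], rule ccontr)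
    fix r assume r: "r \<in> E" "\<not> r \<le> 2 * B + 2"
    have E_D: "vector [0, \<zeta>] \<in> closure D" if "cmod \<zeta> < r" for \<zeta>
      using r(1) that by (simp add: E_def)
    have "vector [0, 0] \<in> closure D" using \<delta>E \<delta> by (simp add: E_def)
    then have "0 \<le> B" by (rule order_trans[OF norm_ge_zero B])
    then have "cmod (of_real (B + 1)) < r" using r(2) by (simp del: of_real_add)
    then have "norm (vector [0, of_real (B + 1)] :: complex ^ 2) \<le> B" by (intro B E_D)
    then have "cmod ((vector [0, of_real (B + 1)] :: complex ^ 2) $ 2) \<le> B"
      by (rule order_trans[OF Finite_Cartesian_Product.norm_nth_le])
    then show False using \<open>0 \<le> B\<close> by (simp del: of_real_add)
  qed
  have \<rho>: "0 < \<rho>" using cSup_upper[OF \<delta>E bdd] \<delta> by (simp add: \<rho>_def)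
  have face: "vector [0, \<zeta>] \<in> closure D" if small: "cmod \<zeta> < \<rho>" for \<zeta>
  proof -
    obtain r where "r \<in> E" "cmod \<zeta> < r"
      using less_cSupD[OF _ small[unfolded \<rho>_def]] \<delta>E by (metis empty_iff)
    then show ?thesis by (simp add: E_def)
  qed
  define \<eta> where "\<eta> = 1 / k\<^sup>2"
  have \<eta>: "0 < \<eta>" "\<eta> < 1" "k\<^sup>2 * \<eta> = 1" using k one_less_power[OF k, of 2] by (simp_all add: \<eta>_def)
  have "\<rho> * (1 + \<eta>) \<notin> E"
  proof
    assume "\<rho> * (1 + \<eta>) \<in> E"
    then have "\<rho> * (1 + \<eta>) \<le> \<rho>" unfolding \<rho>_def using bdd by (rule cSup_upper)
    then show False using \<rho> \<eta> by simp
  qed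
  then obtain \<zeta> where \<zeta>: "cmod \<zeta> < \<rho> * (1 + \<eta>)" "vector [0, \<zeta>] \<notin> closure D"
  proof -
    have "0 \<le> \<rho> * (1 + \<eta>)" using \<rho> \<eta> by simp
    then show ?thesis using that \<open>\<rho> * (1 + \<eta>) \<notin> E\<close> unfolding E_def by blast
  qed
  have "\<exists>a l. inner a (vector [0, \<zeta>]) < l \<and> (\<forall>z\<in>closure D. l < inner a z)"
    by (rule separating_hyperplane_closed_point[OF convex_closure[OF D(1)] closed_closure \<zeta>(2)])
  then obtain a l where a: "inner a (vector [0, \<zeta>]) < l" "\<And>z. z \<in> closure D \<Longrightarrow> l < inner a z"
    by auto
  define \<mu> \<nu> \<gamma> where "\<mu> = cnj (a $ 1)" and "\<nu> = cnj (a $ 2)" and "\<gamma> = - (\<nu> * \<zeta>)"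
  define g where "g z = Re (\<mu> * z $ 1 + \<nu> * z $ 2 + \<gamma>)" for z :: "complex ^ 2"
  have inner_a: "inner a z = Re (\<mu> * z $ 1 + \<nu> * z $ 2)" for z
    by (simp add: inner_vec_def sum_2 inner_complex_def \<mu>_def \<nu>_def)
  have g_pos: "0 < g z" if "z \<in> closure D" for z
    using a(1) a(2)[OF that] unfolding inner_a g_def by (simp add: \<gamma>_def)
  define n where "n = cmod \<nu>"
  have g0: "0 < Re \<gamma>" using g_pos[OF face[of 0]] \<rho> by (simp add: g_def)
  then have \<nu>: "\<nu> \<noteq> 0" and n: "0 < n" by (auto simp: \<gamma>_def n_def)
  define \<theta> where "\<theta> = - cnj \<nu> / of_real n"
  have \<theta>: "cmod \<theta> = 1" using n by (simp add: \<theta>_def norm_divide n_def)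
  have \<nu>\<theta>: "\<nu> * \<theta> = - of_real n"
  proof -
    have "\<nu> * cnj \<nu> = of_real n * of_real n"
      using complex_norm_square[of \<nu>] by (simp add: n_def power2_eq_square)
    then show ?thesis using n by (simp add: \<theta>_def)
  qed
  have \<gamma>_le: "Re \<gamma> \<le> n * (\<rho> * (1 + \<eta>))"
  proof -
    have "Re \<gamma> \<le> cmod \<gamma>" by (rule complex_Re_le_cmod)
    also have "\<dots> = n * cmod \<zeta>" by (simp add: \<gamma>_def n_def norm_mult)
    also have "\<dots> \<le> n * (\<rho> * (1 + \<eta>))" using \<zeta>(1) n by (intro mult_left_mono) auto
    finally show ?thesis .
  qed
  have \<gamma>_ge: "n * \<rho> \<le> Re \<gamma>"
  proof (rule ccontr)
    assume "\<not> n * \<rho> \<le> Re \<gamma>"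
    then have r: "Re \<gamma> / n < \<rho>" using n by (simp add: field_simps)
    have "0 < g (vector [0, of_real (Re \<gamma> / n) * \<theta>])"
      using r g0 n \<theta> by (intro g_pos face) (simp add: norm_mult norm_divide)
    also have "\<dots> = Re (of_real (Re \<gamma> / n) * (\<nu> * \<theta>)) + Re \<gamma>" by (simp add: g_def algebra_simps)
    also have "\<dots> = 0" using n by (simp add: \<nu>\<theta>)
    finally show False by simp
  qed
  define e where "e = \<eta> * \<delta> / 4"
  define s where "s = (1 - \<eta>) * \<rho>"
  define M where "M = cmod \<mu>"
  have e: "0 < e" using \<eta> \<delta> by (simp add: e_def)
  have M: "0 \<le> M" by (simp add: M_def)
  \<comment> \<open>The first bound on \<open>b\<close> leaves room for \<open>w\<close>; the second makes the \<open>z\<^sub>1\<close>-part of \<open>g\<close> negligible at height \<open>b\<close>.\<close>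
  define b where "b = min (e / k) (n * \<rho> * \<eta> / (2 * (M + 1)))"
  have b: "0 < b" using e k n \<rho> \<eta> M by (simp add: b_def)
  have kb: "k * b \<le> e" using k by (simp add: b_def min_def field_simps)
  have be: "b \<le> e" using kb k b mult_right_mono[of 1 k b] by linarith
  have Mb: "M * b \<le> n * \<rho> * \<eta> / 2"
  proof -
    have "M * b \<le> (M + 1) * b" using b by simp
    also have "\<dots> \<le> (M + 1) * (n * \<rho> * \<eta> / (2 * (M + 1)))"
      using M by (intro mult_left_mono) (auto simp: b_def)
    also have "\<dots> = n * \<rho> * \<eta> / 2" using M by (simp add: field_simps)
    finally show ?thesis .
  qed
  show ?thesis
  proof (rule bidisc_corner_gromov_S[where s = s and C = 8 and \<mu> = \<mu> and \<nu> = \<nu> and \<gamma> = \<gamma>,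
        OF _ b kb _ \<theta> _ _ right])
    show "1 \<le> k" "(0::real) < 8" using k by auto
    show "0 < s" using \<eta> \<rho> by (simp add: s_def)
    show "0 < Re (\<mu> * z $ 1 + \<nu> * z $ 2 + \<gamma>)" if "z \<in> D" for z :: "complex ^ 2"
      using g_pos[of z] that closure_subset[of D] unfolding g_def by blast
    show "z \<in> D" if z: "cmod (z $ 1 - of_real (b / 2 + e)) < e" "cmod (z $ 2) < s" for z :: "complex ^ 2"
    proof -
      \<comment> \<open>\<open>z\<close> is a convex combination of a point \<open>y\<close> of the flat disc and a point \<open>z'\<close> of \<open>D\<close> near the origin.\<close>
      define z' :: "complex ^ 2" where "z' = vector [z $ 1 / of_real \<eta>, 0]"
      define y :: "complex ^ 2" where "y = vector [0, z $ 2 / of_real (1 - \<eta>)]"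
      have y: "y \<in> closure D"
        unfolding y_def using z(2) \<eta> by (intro face) (simp add: s_def norm_divide field_simps del: of_real_diff)
      have Re_pos: "0 < Re (z $ 1)"
        using abs_Re_le_cmod[of "z $ 1 - of_real (b / 2 + e)"] z(1) b by simp
      have "cmod (z $ 1) \<le> cmod (z $ 1 - of_real (b / 2 + e)) + cmod (of_real (b / 2 + e))"
        by (metis diff_add_cancel norm_triangle_ineq)
      also have "\<dots> < e + (b / 2 + e)" using z(1) b e by (simp del: of_real_add)
      also have "\<dots> \<le> \<eta> * \<delta>" using be e unfolding e_def by linarith
      finally have "cmod (z $ 1) < \<eta> * \<delta>" .
      then have z': "z' \<in> D"
        using Re_pos \<delta> \<eta> by (intro local) (auto simp: z'_def norm_divide field_simps)
      have "z = (1 - \<eta>) *\<^sub>R y + \<eta> *\<^sub>R z'"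
      proof -
        have "complex_of_real \<eta> \<noteq> 0" "complex_of_real (1 - \<eta>) \<noteq> 0"
          using \<eta> by (simp_all del: of_real_diff)
        then have "\<eta> *\<^sub>R (z $ 1 / of_real \<eta>) = z $ 1" "(1 - \<eta>) *\<^sub>R (z $ 2 / of_real (1 - \<eta>)) = z $ 2"
          by (simp_all add: scaleR_conv_of_real del: of_real_diff)
        then show ?thesis by (simp add: vec_eq_iff forall_2 y_def z'_def del: of_real_diff)
      qed
      moreover have "y \<noteq> z'"
        using Re_pos \<eta> by (auto simp: y_def z'_def vec_eq_iff forall_2)
      ultimately have "z \<in> open_segment z' y"
        using \<eta> by (auto simp: in_segment intro!: exI[of _ "1 - \<eta>"])
      then show ?thesis
        using in_interior_closure_convex_segment[of D z' y] D z' y by (auto simp: interior_open)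
    qed
    show "k\<^sup>2 * Re (\<mu> * of_real b + \<nu> * (of_real (s * (1 - 1 / k\<^sup>2)) * \<theta>) + \<gamma>)
      \<le> 8 * Re (\<mu> * of_real b + \<gamma>)"
    proof -
      have "\<bar>Re \<mu>\<bar> * b \<le> M * b" using b abs_Re_le_cmod by (intro mult_right_mono) (auto simp: M_def)
      moreover have "\<bar>Re \<mu> * b\<bar> = \<bar>Re \<mu>\<bar> * b" using b by (simp add: abs_mult)
      ultimately have \<mu>b: "\<bar>Re \<mu> * b\<bar> \<le> n * \<rho> * \<eta> / 2" using Mb by linarith
      have "Re (\<nu> * (of_real (s * (1 - \<eta>)) * \<theta>)) = Re (of_real (s * (1 - \<eta>)) * (\<nu> * \<theta>))"
        by (simp add: algebra_simps)
      also have "\<dots> = - (s * (1 - \<eta>) * n)" unfolding \<nu>\<theta> by simp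
      finally have \<nu>s: "Re (\<nu> * (of_real (s * (1 - \<eta>)) * \<theta>)) = - (n * \<rho> * (1 - \<eta>)\<^sup>2)"
        by (simp add: s_def power2_eq_square)
      define c where "c = n * \<rho>"
      have c: "0 < c" using n \<rho> by (simp add: c_def)
      have "Re \<mu> * b - c * (1 - \<eta>)\<^sup>2 + Re \<gamma> \<le> c * \<eta> / 2 - c * (1 - \<eta>)\<^sup>2 + c * (1 + \<eta>)"
        using \<mu>b \<gamma>_le by (simp add: c_def mult.assoc)
      also have "\<dots> = 7 / 2 * (c * \<eta>) - c * \<eta>\<^sup>2" by (simp add: power2_eq_square algebra_simps)
      also have "\<dots> \<le> 7 / 2 * (c * \<eta>)" using c by simp
      finally have "k\<^sup>2 * (Re \<mu> * b - c * (1 - \<eta>)\<^sup>2 + Re \<gamma>) \<le> k\<^sup>2 * (7 / 2 * (c * \<eta>))"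
        by (intro mult_left_mono) auto
      also have "\<dots> = 7 / 2 * c * (k\<^sup>2 * \<eta>)" by (simp only: ac_simps)
      also have "\<dots> \<le> 8 * (c - c / 2)" using \<eta>(3) c by simp
      also have "\<dots> \<le> 8 * (Re \<mu> * b + Re \<gamma>)"
      proof -
        have "c * \<eta> \<le> c" using c \<eta> by (simp add: mult_left_le)
        moreover have "8 * (c - c / 2) \<le> 8 * (u + v)" if "h \<le> c" "\<bar>u\<bar> \<le> h / 2" "c \<le> v" for u v h :: real
          using that by (simp add: abs_le_iff)
        ultimately show ?thesis using \<mu>b \<gamma>_ge unfolding c_def[symmetric] by blast
      qed
      finally show ?thesis
        using \<nu>s by (simp add: \<eta>_def[symmetric] c_def)
    qed
  qed
qed

section \<open>Boundary points of infinite type\<close>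

text \<open>
  A bound \<open>r \<psi>'(r) \<le> N \<psi>(r)\<close> near \<open>0\<close> would make \<open>\<psi>(r) / r\<^sup>N\<close> nonincreasing, hence
  \<open>\<psi>(r) \<ge> const r\<^sup>N\<close>, and then \<open>ln \<psi>(r) / ln r\<close> would stay bounded as \<open>r\<close> tends to \<open>0\<close>.
\<close>

lemma unbounded_log_derivative:
  fixes \<psi> \<psi>' :: "real \<Rightarrow> real"
  assumes pos: "\<And>r. 0 < r \<Longrightarrow> r < \<epsilon> \<Longrightarrow> 0 < \<psi> r"
    and deriv: "\<And>r. 0 < r \<Longrightarrow> r < \<epsilon> \<Longrightarrow> (\<psi> has_real_derivative \<psi>' r) (at r)"
    and lim: "Limsup (at 0) (\<lambda>x. log_ext (\<psi> \<bar>x\<bar>) / log_ext \<bar>x\<bar>) = \<infinity>"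
    and r0: "0 < r0" "r0 \<le> \<epsilon>" and N: "0 \<le> N"
  shows "\<exists>r. 0 < r \<and> r < r0 \<and> N * \<psi> r < r * \<psi>' r"
proof (rule ccontr)
  assume "\<not> ?thesis"
  then have le: "r * \<psi>' r \<le> N * \<psi> r" if "0 < r" "r < r0" for r using that not_less by blast
  define c where "c = r0 / 2"
  have c: "0 < c" "c < r0" using r0 by (auto simp: c_def)
  define A where "A = ln (\<psi> c) - N * ln c"
  have lower: "N * ln r + A \<le> ln (\<psi> r)" if r: "0 < r" "r \<le> c" for r
  proof -
    have "ln (\<psi> c) - N * ln c \<le> ln (\<psi> r) - N * ln r"
    proof (rule DERIV_nonpos_imp_nonincreasing[OF r(2)])
      fix x assume x: "r \<le> x" "x \<le> c"
      then have x0: "0 < x" "x < r0" "x < \<epsilon>" using r c r0 by auto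
      have "((\<lambda>r. ln (\<psi> r) - N * ln r) has_real_derivative \<psi>' x / \<psi> x - N * (1 / x)) (at x)"
        using pos[OF x0(1,3)] x0 by (auto intro!: derivative_eq_intros deriv)
      moreover have "\<psi>' x / \<psi> x - N * (1 / x) \<le> 0"
        using le[OF x0(1,2)] pos[OF x0(1,3)] x0 by (simp add: field_simps)
      ultimately show "\<exists>y. ((\<lambda>r. ln (\<psi> r) - N * ln r) has_real_derivative y) (at x) \<and> y \<le> 0" by blast
    qed
    then show ?thesis by (simp add: A_def)
  qed
  have "\<forall>\<^sub>F x in at 0. log_ext (\<psi> \<bar>x\<bar>) / log_ext \<bar>x\<bar> \<le> ereal (N + \<bar>A\<bar>)"
    unfolding eventually_at
  \<comment> \<open>For \<open>|x| < exp (-1)\<close> the inequality \<open>ln |x| < -1\<close> holds, so that dividing by \<open>ln |x|\<close> costs at most \<open>|A|\<close>.\<close>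
  proof (intro exI[of _ "min c (exp (- 1))"] conjI ballI impI)
    fix x :: real assume "x \<noteq> 0 \<and> dist x 0 < min c (exp (- 1))"
    then have x: "0 < \<bar>x\<bar>" "\<bar>x\<bar> \<le> c" "\<bar>x\<bar> < exp (- 1)" by auto
    have "ln \<bar>x\<bar> < ln (exp (- 1))" using x by (subst ln_less_cancel_iff) auto
    then have ln1: "ln \<bar>x\<bar> < - 1" by simp
    have p: "0 < \<psi> \<bar>x\<bar>" using pos x c r0 by simp
    have "\<bar>A\<bar> * ln \<bar>x\<bar> \<le> \<bar>A\<bar> * (- 1)" using ln1 by (intro mult_left_mono) auto
    then have "(N + \<bar>A\<bar>) * ln \<bar>x\<bar> \<le> N * ln \<bar>x\<bar> + A" by (simp add: distrib_right)
    also have "\<dots> \<le> ln (\<psi> \<bar>x\<bar>)" using lower x by blast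
    finally have "ln (\<psi> \<bar>x\<bar>) / ln \<bar>x\<bar> \<le> N + \<bar>A\<bar>" using ln1 by (simp add: divide_le_eq)
    moreover have "log_ext (\<psi> \<bar>x\<bar>) / log_ext \<bar>x\<bar> = ereal (ln (\<psi> \<bar>x\<bar>) / ln \<bar>x\<bar>)"
      using p x(1) ln1 by (auto simp: log_ext_def)
    ultimately show "log_ext (\<psi> \<bar>x\<bar>) / log_ext \<bar>x\<bar> \<le> ereal (N + \<bar>A\<bar>)" by simp
  qed (use c in auto)
  then have "Limsup (at 0) (\<lambda>x. log_ext (\<psi> \<bar>x\<bar>) / log_ext \<bar>x\<bar>) \<le> ereal (N + \<bar>A\<bar>)"
    by (rule Limsup_bounded)
  then show False using lim by simp
qed

text \<open>
  Let \<open>g z = z\<^sub>1 - \<psi>(r) - m (z\<^sub>2 - r)\<close> be the tangent plane at \<open>(\<psi>(r), r)\<close>, where \<open>m r = k\<^sup>2 \<psi>(r)\<close>. At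
  height \<open>2 \<psi>(r)\<close> it is at least \<open>m r\<close> on the axis \<open>z\<^sub>2 = 0\<close> and equals \<open>2 \<psi>(r)\<close> at distance \<open>r / k\<^sup>2\<close>
  from the edge of the bidisc of radius \<open>r\<close>, because moving inwards by \<open>r / k\<^sup>2\<close> changes \<open>g\<close>
  by exactly \<open>m r / k\<^sup>2 = \<psi>(r)\<close>. The ratio \<open>k\<^sup>2 / 2\<close> is what the four-point configuration needs.
\<close>

lemma tangent_gromov_S:
  fixes D :: "(complex ^ 2) set" and \<psi> :: "real \<Rightarrow> real" and \<epsilon> \<delta> r m :: real
  assumes D: "convex D" "open D" and \<delta>: "0 < \<delta>" "\<delta> \<le> \<epsilon>"
    and local: "\<And>z. cmod (z $ 1) < \<delta> \<Longrightarrow> cmod (z $ 2) < \<delta> \<Longrightarrow>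
      z \<in> D \<longleftrightarrow> \<psi> (cmod (z $ 2)) < Re (z $ 1)"
    and right: "\<And>z. z \<in> D \<Longrightarrow> 0 < Re (z $ 1)"
    and mono: "\<And>x y. 0 \<le> x \<Longrightarrow> x \<le> y \<Longrightarrow> y < \<epsilon> \<Longrightarrow> \<psi> x \<le> \<psi> y"
    and r: "0 < r" "r < \<delta>" and \<psi>r: "0 < \<psi> r"
    and tangent: "\<And>y. 0 \<le> y \<Longrightarrow> y < \<epsilon> \<Longrightarrow> \<psi> r + m * (y - r) \<le> \<psi> y"
    and k: "1 \<le> k" "k\<^sup>2 * \<psi> r = m * r" and small: "6 * (m * r) \<le> \<delta>"
  shows "\<exists>p\<in>D. \<exists>q\<in>D. \<exists>x\<in>D. \<exists>w\<in>D. ln (k / (16 * 2)) / 2 \<le> gromov_S (kobayashi D) p q x w"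
proof -
  \<comment> \<open>The bidisc starts at height \<open>b / 2 = \<psi> r\<close>, which is just above the graph of \<open>\<psi>\<close> over \<open>|z\<^sub>2| < r\<close>.\<close>
  define b where "b = 2 * \<psi> r"
  define e where "e = \<delta> / 3"
  define y :: "complex ^ 2" where "y = vector [of_real (\<psi> r), of_real r]"
  define V where "V = {z :: complex ^ 2. cmod (z $ 1) < \<delta> \<and> cmod (z $ 2) < \<delta>}"
  have b: "0 < b" using \<psi>r by (simp add: b_def)
  have m: "0 < m"
  proof -
    have "0 < k\<^sup>2 * \<psi> r" using k(1) \<psi>r by simp
    then show ?thesis using k(2) r(1) by (simp add: zero_less_mult_iff)
  qed
  have kmr: "k * \<psi> r \<le> m * r"
  proof -
    have "k * \<psi> r \<le> k\<^sup>2 * \<psi> r" using k(1) \<psi>r by (intro mult_right_mono) (auto simp: power2_eq_square)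
    then show ?thesis using k(2) by simp
  qed
  have kb: "k * b \<le> e" using kmr small by (simp add: b_def e_def)
  have be: "b \<le> e" using kb k b mult_right_mono[of 1 k b] by linarith
  have \<psi>\<delta>: "\<psi> r < \<delta>" using be b \<delta> by (simp add: b_def e_def)
  have "open V" unfolding V_def by (rule open_bidisc)
  have yV: "y \<in> V" using r \<psi>r \<psi>\<delta> by (simp add: V_def y_def)
  have yD: "y \<in> closure D"
    unfolding y_def
  proof (rule closure_approached_from_right[of "\<delta> - \<psi> r"])
    fix t assume t: "0 < t" "t < \<delta> - \<psi> r"
    have "cmod (of_real (\<psi> r + t)) < \<delta>" using t \<psi>r by (simp del: of_real_add)
    then show "vector [of_real (\<psi> r + t), of_real r] \<in> D"
      using r t local[of "vector [of_real (\<psi> r + t), of_real r]"] by simp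
  qed (use \<psi>\<delta> in simp)
  show ?thesis
  proof (rule bidisc_corner_gromov_S[where \<theta> = 1 and \<mu> = 1 and \<nu> = "- of_real m" and \<gamma> = "of_real (m * r - \<psi> r)",
        OF k(1) b kb r(1) _ _ _ right])
    show "cmod 1 = 1" "(0::real) < 2" by auto
    show "z \<in> D" if z: "cmod (z $ 1 - of_real (b / 2 + e)) < e" "cmod (z $ 2) < r" for z :: "complex ^ 2"
    proof -
      have "b / 2 < Re (z $ 1)"
        using abs_Re_le_cmod[of "z $ 1 - of_real (b / 2 + e)"] z(1) by simp
      moreover have "\<psi> (cmod (z $ 2)) \<le> \<psi> r" using z(2) r \<delta> by (intro mono) auto
      moreover have "cmod (z $ 1) < \<delta>"
      proof -
        have "cmod (z $ 1) \<le> cmod (z $ 1 - of_real (b / 2 + e)) + cmod (of_real (b / 2 + e))"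
          by (metis diff_add_cancel norm_triangle_ineq)
        also have "\<dots> < e + (b / 2 + e)" using z(1) b be by (simp del: of_real_add)
        also have "\<dots> \<le> \<delta>" using be b by (simp add: e_def)
        finally show ?thesis .
      qed
      ultimately show ?thesis using z(2) r local[of z] by (simp add: b_def)
    qed
    show "0 < Re (1 * z $ 1 + - of_real m * z $ 2 + of_real (m * r - \<psi> r))" if z: "z \<in> D" for z :: "complex ^ 2"
    proof (rule convex_local_support_imp_positive[OF D \<open>open V\<close> yV yD _ _ z])
      show "Re (1 * y $ 1 + - of_real m * y $ 2 + of_real (m * r - \<psi> r)) = 0" by (simp add: y_def)
      fix z assume "z \<in> D \<inter> V"
      then have z: "cmod (z $ 2) < \<delta>" "\<psi> (cmod (z $ 2)) < Re (z $ 1)"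
        using local[of z] by (auto simp: V_def)
      have "m * Re (z $ 2) \<le> m * cmod (z $ 2)" using m complex_Re_le_cmod by simp
      moreover have "\<psi> r + m * (cmod (z $ 2) - r) \<le> \<psi> (cmod (z $ 2))" using z \<delta> by (intro tangent) auto
      ultimately show "0 < Re (1 * z $ 1 + - of_real m * z $ 2 + of_real (m * r - \<psi> r))"
        using z(2) by (simp add: algebra_simps)
    qed
    show "k\<^sup>2 * Re (1 * of_real b + - of_real m * (of_real (r * (1 - 1 / k\<^sup>2)) * 1) + of_real (m * r - \<psi> r))
      \<le> 2 * Re (1 * of_real b + of_real (m * r - \<psi> r))"
    proof -
      have "k\<^sup>2 * (b - m * (r * (1 - 1 / k\<^sup>2)) + (m * r - \<psi> r)) = k\<^sup>2 * \<psi> r + m * r"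
        using k(1) by (simp add: b_def field_simps)
      also have "\<dots> \<le> 2 * (b + (m * r - \<psi> r))" using k(2) \<psi>r by (simp add: b_def)
      finally show ?thesis by (simp add: algebra_simps)
    qed
  qed
qed

section \<open>Failure of Gromov hyperbolicity\<close>

theorem theorem2:
  fixes D U :: "(complex ^ 2) set" and \<psi> :: "real \<Rightarrow> real" and \<epsilon> :: real
  assumes "C11_smooth_domain D" and "convex D" and "bounded D"
    and "0 < \<epsilon>" and "C11_on {-\<epsilon><..<\<epsilon>} \<psi>" and "convex_on {-\<epsilon><..<\<epsilon>} \<psi>"
    and "\<forall>x\<in>{-\<epsilon><..<\<epsilon>}. 0 \<le> \<psi> x" and "\<psi> 0 = 0"
    and "Limsup (at 0) (\<lambda>x. log_ext (\<psi> \<bar>x\<bar>) / log_ext \<bar>x\<bar>) = \<infinity>"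
    and "open U" and "0 \<in> U"
    and "D \<inter> U = {z \<in> U. - Re (z $ 1) + \<psi> (cmod (z $ 2)) < 0}"
  shows "\<not> gromov_k_hyperbolic D"
proof
  assume "gromov_k_hyperbolic D"
  define I where "I = {-\<epsilon><..<\<epsilon>}"
  have "open D" using assms(1) by (simp add: C11_smooth_domain_def)
  obtain \<psi>' where deriv: "\<And>x. x \<in> I \<Longrightarrow> (\<psi> has_real_derivative \<psi>' x) (at x)"
    using assms(5) unfolding C11_on_def gderiv_deriv I_def by blast
  have tangent: "\<psi> x + \<psi>' x * (y - x) \<le> \<psi> y" if "x \<in> I" "y \<in> I" for x y
    using convex_on_imp_above_tangent[OF assms(6)[folded I_def], of x y "\<psi>' x"] that
      has_field_derivative_at_within[OF deriv[OF that(1)]]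
    by (simp add: I_def interior_open algebra_simps)
  have nonneg: "0 \<le> \<psi> x" if "x \<in> I" for x using assms(7) that by (simp add: I_def)
  have \<psi>'_nonneg: "0 \<le> \<psi>' x" if "0 < x" "x < \<epsilon>" for x
  proof -
    have "\<psi> x \<le> \<psi>' x * x" using tangent[of x 0] that assms(8) by (simp add: I_def)
    then have "0 \<le> \<psi>' x * x" using nonneg[of x] that by (simp add: I_def)
    then show ?thesis using that by (simp add: zero_le_mult_iff)
  qed
  have mono: "\<psi> x \<le> \<psi> y" if "0 \<le> x" "x \<le> y" "y < \<epsilon>" for x y
  proof (cases "x = 0")
    case True
    then show ?thesis using nonneg[of y] that assms(8) by (simp add: I_def)
  next
    case False
    then have "0 \<le> \<psi>' x * (y - x)" using \<psi>'_nonneg[of x] that by simp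
    then show ?thesis using tangent[of x y] that by (simp add: I_def)
  qed
  obtain B where B: "\<And>p q x w. p \<in> D \<Longrightarrow> q \<in> D \<Longrightarrow> x \<in> D \<Longrightarrow> w \<in> D \<Longrightarrow>
      gromov_S (kobayashi D) p q x w \<le> B"
  proof -
    define M where "M = (SUP (p, q, x, w) \<in> D \<times> D \<times> D \<times> D. ereal (gromov_S (kobayashi D) p q x w))"
    have M: "M < \<infinity>"
      using \<open>gromov_k_hyperbolic D\<close> by (simp add: gromov_k_hyperbolic_def gromov_hyperbolic_def M_def)
    have le: "ereal (gromov_S (kobayashi D) p q x w) \<le> M"
      if "p \<in> D" "q \<in> D" "x \<in> D" "w \<in> D" for p q x w
      unfolding M_def using that by (intro SUP_upper2[of "(p, q, x, w)"]) auto
    show thesis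
    proof (cases M)
      case (real c)
      then show ?thesis using that[of c] le by simp
    next
      case PInf
      then show ?thesis using M by simp
    next
      case MInf
      then show ?thesis using that[of 0] le by fastforce
    qed
  qed
  obtain \<delta>0 where \<delta>0: "0 < \<delta>0" "ball 0 \<delta>0 \<subseteq> U" using assms(10,11) openE by blast
  define \<delta> where "\<delta> = min (\<delta>0 / 2) \<epsilon>"
  have \<delta>: "0 < \<delta>" "\<delta> \<le> \<epsilon>" using \<delta>0 assms(4) by (auto simp: \<delta>_def)
  have local: "z \<in> D \<longleftrightarrow> \<psi> (cmod (z $ 2)) < Re (z $ 1)"
    if "cmod (z $ 1) < \<delta>" "cmod (z $ 2) < \<delta>" for z :: "complex ^ 2"
  proof -
    have "norm z < \<delta>0" using norm_le_cmod_add[of z] that by (simp add: \<delta>_def)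
    then have "z \<in> U" using \<delta>0 by auto
    then show ?thesis using assms(12) by auto
  qed
  have right: "0 < Re (z $ 1)" if z: "z \<in> D" for z :: "complex ^ 2"
  proof -
    define V where "V = {z :: complex ^ 2. cmod (z $ 1) < \<delta> \<and> cmod (z $ 2) < \<delta>}"
    have "open V" unfolding V_def by (rule open_bidisc)
    have "vector [of_real 0, 0] \<in> closure D"
    proof (rule closure_approached_from_right[OF \<delta>(1)])
      fix t assume t: "0 < t" "t < \<delta>"
      then show "vector [of_real (0 + t), 0] \<in> D"
        using assms(8) \<delta> local[of "vector [of_real (0 + t), 0]"] by simp
    qed
    moreover have "vector [of_real 0, 0] = (0 :: complex ^ 2)" by (simp add: vec_eq_iff forall_2)
    ultimately have "0 \<in> closure D" by simp
    moreover have "0 < Re (1 * z $ 1 + 0 * z $ 2 + 0)" if "z \<in> D \<inter> V" for z :: "complex ^ 2"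
      using that local[of z] nonneg[of "cmod (z $ 2)"] \<delta> norm_ge_zero[of "z $ 2"]
      by (auto simp: V_def I_def simp del: norm_ge_zero)
    ultimately show ?thesis
      using convex_local_support_imp_positive[OF assms(2) \<open>open D\<close> \<open>open V\<close>, of 0 1 0 0 z] \<delta> z
      by (simp add: V_def)
  qed
  \<comment> \<open>Large enough for \<open>ln (k0 / (16 C)) / 2\<close> to exceed \<open>B\<close> for the constants \<open>C = 2\<close> and \<open>C = 8\<close> of the two cases.\<close>
  define k0 where "k0 = 2 * (16 * 8) * exp (2 * \<bar>B\<bar>)"
  have k0: "1 < k0"
  proof -
    have "1 \<le> exp (2 * \<bar>B\<bar>)" by simp
    then show ?thesis unfolding k0_def by linarith
  qed
  have large: "B < ln (k / (16 * C)) / 2" if "k0 \<le> k" "0 < C" "C \<le> 8" for k C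
  proof -
    have "exp (2 * \<bar>B\<bar>) * (16 * C) \<le> exp (2 * \<bar>B\<bar>) * (16 * 8)" using that by simp
    also have "\<dots> < k" using that(1) by (simp add: k0_def) (use exp_gt_zero[of "2 * \<bar>B\<bar>"] in linarith)
    finally have "exp (2 * \<bar>B\<bar>) < k / (16 * C)" using that by (simp add: field_simps)
    then have "ln (exp (2 * \<bar>B\<bar>)) < ln (k / (16 * C))"
      using order.strict_trans[OF exp_gt_zero] by (subst ln_less_cancel_iff) auto
    then show ?thesis by simp
  qed
  show False
  proof (cases "\<exists>r. 0 < r \<and> r < \<epsilon> \<and> \<psi> r = 0")
    case True
    then obtain r where r: "0 < r" "r < \<epsilon>" "\<psi> r = 0" by blast
    have "z \<in> D" if "0 < Re (z $ 1)" "cmod (z $ 1) < min \<delta> r" "cmod (z $ 2) < min \<delta> r" for z :: "complex ^ 2"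
      using that local[of z] mono[of "cmod (z $ 2)" r] r by auto
    then have "\<exists>p\<in>D. \<exists>q\<in>D. \<exists>x\<in>D. \<exists>w\<in>D. ln (k0 / (16 * 8)) / 2 \<le> gromov_S (kobayashi D) p q x w"
      using flat_disc_gromov_S[OF assms(2) \<open>open D\<close> assms(3) _ k0 _ right, of "min \<delta> r"] \<delta>(1) r(1)
      by simp
    then obtain p q x w where "p \<in> D" "q \<in> D" "x \<in> D" "w \<in> D"
      "ln (k0 / (16 * 8)) / 2 \<le> gromov_S (kobayashi D) p q x w" by blast
    then show False using B[of p q x w] large[of k0 8] by simp
  next
    case False
    then have pos: "0 < \<psi> r" if "0 < r" "r < \<epsilon>" for r
      using nonneg[of r] that by (force simp: I_def)
    \<comment> \<open>Slopes near \<open>0\<close> are at most \<open>S\<close>, so \<open>r \<psi>' r\<close>, which bounds the height of \<open>w\<close> up to a factor, tends to \<open>0\<close>.\<close>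
    define S where "S = 4 * \<psi> (\<epsilon> / 2) / \<epsilon>"
    have S: "0 < S" using pos assms(4) by (simp add: S_def)
    have slope: "\<psi>' r \<le> S" if "0 < r" "r \<le> \<epsilon> / 4" for r
    proof -
      have "\<psi>' r * (\<epsilon> / 4) \<le> \<psi>' r * (\<epsilon> / 2 - r)"
        using that \<psi>'_nonneg[of r] by (intro mult_left_mono) auto
      also have "\<dots> \<le> \<psi> (\<epsilon> / 2)" using tangent[of r "\<epsilon> / 2"] pos[of r] that by (simp add: I_def)
      finally show ?thesis using assms(4) by (simp add: S_def field_simps)
    qed
    define r0 where "r0 = min (min \<delta> (\<epsilon> / 4)) (\<delta> / (6 * S))"
    have r0: "0 < r0" "r0 \<le> \<epsilon>" using \<delta> assms(4) S by (auto simp: r0_def)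
    obtain r where r: "0 < r" "r < r0" "k0\<^sup>2 * \<psi> r < r * \<psi>' r"
      using unbounded_log_derivative[of \<epsilon> \<psi> \<psi>' r0 "k0\<^sup>2"] pos deriv assms(9) r0 by (auto simp: I_def)
    have r': "r < \<delta>" "r < \<epsilon>" "r \<le> \<epsilon> / 4" "r * (6 * S) \<le> \<delta>"
      using r r0 S by (auto simp: r0_def less_divide_eq)
    define k where "k = sqrt (r * \<psi>' r / \<psi> r)"
    have \<psi>r: "0 < \<psi> r" using pos r r' by simp
    have "k0\<^sup>2 \<le> r * \<psi>' r / \<psi> r" using r(3) \<psi>r by (simp add: le_divide_eq)
    then have k: "k0 \<le> k" by (simp add: k_def real_le_rsqrt)
    have k2: "k\<^sup>2 * \<psi> r = \<psi>' r * r"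
      using \<psi>r \<psi>'_nonneg[of r] r r' by (simp add: k_def mult.commute)
    have "\<psi>' r * r \<le> S * r" using slope r r' by simp
    then have small: "6 * (\<psi>' r * r) \<le> \<delta>" using r'(4) by (simp add: algebra_simps)
    have "\<exists>p\<in>D. \<exists>q\<in>D. \<exists>x\<in>D. \<exists>w\<in>D. ln (k / (16 * 2)) / 2 \<le> gromov_S (kobayashi D) p q x w"
    proof (rule tangent_gromov_S[OF assms(2) \<open>open D\<close> \<delta> local right mono r(1) r'(1) \<psi>r _ _ k2 small])
      show "\<psi> r + \<psi>' r * (y - r) \<le> \<psi> y" if "0 \<le> y" "y < \<epsilon>" for y
        using that r(1) r'(2) by (intro tangent) (auto simp: I_def)
      show "1 \<le> k" using k k0 by linarith
    qed
    then obtain p q x w where "p \<in> D" "q \<in> D" "x \<in> D" "w \<in> D"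
      "ln (k / (16 * 2)) / 2 \<le> gromov_S (kobayashi D) p q x w" by blast
    then show False using B[of p q x w] large[of k 2] k by simp
  qed
qed

end
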